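(* Let $H=\langle m_0,\dots,m_p,n\rangle$ be a numerical semigroup minimally generated by an almost arithmetic sequence, with associated data as in the context, and assume $W\ne\emptyset$. Suppose $r=1$ and $\lambda>1$. Then for each $\beta_j\in\mathrm{PF}_2(H)$, $j\in[1,p]$, there exists an $\mathrm{RF}$-matrix for $\beta_j$ whose rows (indexed by $0,1,\dots,p,n$) are: (1) row $0$: $-E_0+(q-1)E_p+(v-w-1)E_n+E_j$; (2) row $k$ for $k\in[1,p-j]$: $-E_k+(q-1)E_p+(v-w-1)E_n+E_{j+k}$; (3) row $k$ for $k\in[p-j+1,p]$: $(\lambda-2)E_0-E_k+(v-1)E_n+E_{k+j-p-1}$; (4) row $n$: $(\nu-\epsilon)E_0+q_{z+j-p-1}E_p-E_n+E_{r_{z+j-p-1}}$, where $\epsilon=2$ if $r'+r_{z+j-p-1}\le p$ and $\epsilon=1$ if $r'+r_{z+j-p-1}>p$.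
   Context: Notation: $\mathbb N=\{0,1,2,\dots\}$; $[a,b]$ is the set of integers $i$ with $a\le i\le b$. Let $p\ge1$, $d\ge1$, $m_0\ge 1$ be integers, $m_i=m_0+id$ for $i\in[0,p]$, and $n\ge1$ an integer with $\gcd(m_0,d,n)=1$. Put $H'=\sum_{i=0}^p\mathbb Nm_i$ and $H=H'+\mathbb Nn=\langle m_0,\dots,m_p,n\rangle$; assume $\{m_0,\dots,m_p,n\}$ is a minimal generating set of $H$. $\mathrm{Ap}(H,m_0)=\{h\in H: h-m_0\notin H\}$. For $t\in\mathbb N$ write $t=q_tp+r_t$ with $q_t\in\mathbb Z$, $r_t\in[1,p]$, and set $g_t=q_tm_p+m_{r_t}$ (so $q_0=-1$, $r_0=p$, $g_0=0$). Let $u=\min\{t\in\mathbb N: g_t\notin\mathrm{Ap}(H,m_0)\}$ and $v=\min\{b\ge1: bn\in H'\}$. It is known (Patil–Singh) that there are unique integers $z\in[0,u-1]$, $w\in[0,v-1]$, $\lambda\ge1$, $\mu\ge0$ with $g_u=\lambda m_0+wn$, $vn=\mu m_0+g_z$, and $g_{u-z}+(v-w)n=\nu m_0$, where $\nu=\lambda+\mu+1$ if $r_{u-z}<r_u$ and $\nu=\lambda+\mu$ if $r_{u-z}\ge r_u$. Set $r=r_u$, $q=q_u$, $r'=r_{u-z}$, $q'=q_{u-z}$, and $W=[u-z,u-1]\times[v-w,v-1]$ (empty iff $z=0$ or $w=0$). $\mathrm{PF}(H)$ is the set of $f\in\mathbb Z\setminus H$ with $f+h\in H$ for all $h\in H\setminus\{0\}$.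 An $\mathrm{RF}$-matrix for $f\in\mathrm{PF}(H)$ is a $(p+2)\times(p+2)$ integer matrix with rows and columns indexed by $0,1,\dots,p,n$ (corresponding to the generators $m_0,\dots,m_p,n$), with all diagonal entries $-1$, all off-diagonal entries in $\mathbb N$, and such that each row $(b_0,\dots,b_p,b_n)$ satisfies $\sum_{j=0}^p b_jm_j+b_nn=f$. $E_0,\dots,E_p,E_n$ denote the standard basis vectors of $\mathbb Z^{p+2}$ (coordinates indexed by $0,\dots,p,n$). When $W\neq\emptyset$, let $\beta_j=g_{(q-1)p+r+j-1}+(v-w-1)n-m_0$ for $j\in[1,p]$. $\mathrm{PF}_2(H)$ denotes the set of pseudo-Frobenius numbers of $H$ of the form $\beta_j$ with $j\in[1,p]$ if $r=1$, and with $j\in[p-r+2,p]$ if $r\ge2$. *)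

theory Defs
  imports "Jordan_Normal_Form.Matrix"
begin

(* The submonoid generated by a finite set X; not meaningful for infinite X, where the sum is 0. *)
definition nat_span :: "int set \<Rightarrow> int set" where
  "nat_span X = {\<Sum>x\<in>X. int (c x) * x | c :: int \<Rightarrow> nat. True}"

definition minimal_generating_set :: "int set \<Rightarrow> int set \<Rightarrow> bool" where
  "minimal_generating_set X H \<longleftrightarrow> nat_span X = H \<and> (\<forall>Y. Y \<subset> X \<longrightarrow> nat_span Y \<noteq> H)"

definition Apery :: "int set \<Rightarrow> int \<Rightarrow> int set" where
  "Apery H a = {h \<in> H. h - a \<notin> H}"

definition pseudo_Frobenius :: "int set \<Rightarrow> int set" where
  "pseudo_Frobenius H = {f. f \<notin> H \<and> (\<forall>h \<in> H - {0}. f + h \<in> H)}"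

definition m_seq :: "nat \<Rightarrow> nat \<Rightarrow> nat \<Rightarrow> int" where
  "m_seq m0 d i = int m0 + int i * int d"

definition arith_gens :: "nat \<Rightarrow> nat \<Rightarrow> nat \<Rightarrow> int set" where
  "arith_gens p m0 d = m_seq m0 d ` {0..p}"

definition almost_arith_gens :: "nat \<Rightarrow> nat \<Rightarrow> nat \<Rightarrow> nat \<Rightarrow> int set" where
  "almost_arith_gens p m0 d n = insert (int n) (arith_gens p m0 d)"

abbreviation H_arith :: "nat \<Rightarrow> nat \<Rightarrow> nat \<Rightarrow> int set" where
  "H_arith p m0 d \<equiv> nat_span (arith_gens p m0 d)"

abbreviation H_almost :: "nat \<Rightarrow> nat \<Rightarrow> nat \<Rightarrow> nat \<Rightarrow> int set" where
  "H_almost p m0 d n \<equiv> nat_span (almost_arith_gens p m0 d n)"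

(* For p > 0, t = q_idx p t * p + r_idx p t with 1 <= r_idx p t <= p.  The index t is an
   integer so that differences of indices are not truncated; only t >= 0 has a meaning in
   the source.  In particular q_idx p 0 = -1 and r_idx p 0 = p. *)
definition q_idx :: "nat \<Rightarrow> int \<Rightarrow> int" where
  "q_idx p t = (t - 1) div int p"

definition r_idx :: "nat \<Rightarrow> int \<Rightarrow> nat" where
  "r_idx p t = nat ((t - 1) mod int p) + 1"

lemma q_idx_r_idx:
  assumes "p \<ge> 1"
  shows "t = q_idx p t * int p + int (r_idx p t)" and "r_idx p t \<in> {1..p}"
proof -
  have b: "0 \<le> (t - 1) mod int p" "(t - 1) mod int p < int p"
    using assms by auto
  show "t = q_idx p t * int p + int (r_idx p t)"
    using b div_mult_mod_eq[of "t - 1" "int p"] by (simp add: q_idx_def r_idx_def)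
  show "r_idx p t \<in> {1..p}"
    using b by (auto simp: r_idx_def)
qed

definition g_seq :: "nat \<Rightarrow> nat \<Rightarrow> nat \<Rightarrow> int \<Rightarrow> int" where
  "g_seq p m0 d t = q_idx p t * m_seq m0 d p + m_seq m0 d (r_idx p t)"

definition u_min :: "nat \<Rightarrow> nat \<Rightarrow> nat \<Rightarrow> nat \<Rightarrow> nat" where
  "u_min p m0 d n = (LEAST t. g_seq p m0 d (int t) \<notin> Apery (H_almost p m0 d n) (int m0))"

definition v_min :: "nat \<Rightarrow> nat \<Rightarrow> nat \<Rightarrow> nat \<Rightarrow> nat" where
  "v_min p m0 d n = (LEAST b. b \<ge> 1 \<and> int b * int n \<in> H_arith p m0 d)"

definition nu :: "nat \<Rightarrow> int \<Rightarrow> int \<Rightarrow> int \<Rightarrow> int \<Rightarrow> int" where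
  "nu p u z lam \<mu> = (if r_idx p (u - z) < r_idx p u then lam + \<mu> + 1 else lam + \<mu>)"

definition W_box :: "int \<Rightarrow> int \<Rightarrow> int \<Rightarrow> int \<Rightarrow> (int \<times> int) set" where
  "W_box u v z w = {u - z..u - 1} \<times> {v - w..v - 1}"

definition PF_beta :: "nat \<Rightarrow> nat \<Rightarrow> nat \<Rightarrow> nat \<Rightarrow> int \<Rightarrow> int \<Rightarrow> int \<Rightarrow> nat \<Rightarrow> int" where
  "PF_beta p m0 d n u v w j =
     g_seq p m0 d ((q_idx p u - 1) * int p + int (r_idx p u) + int j - 1)
     + (v - w - 1) * int n - int m0"

definition PF2 :: "nat \<Rightarrow> nat \<Rightarrow> nat \<Rightarrow> nat \<Rightarrow> int \<Rightarrow> int \<Rightarrow> int \<Rightarrow> int set" where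
  "PF2 p m0 d n u v w =
     {PF_beta p m0 d n u v w j | j.
        j \<in> (if r_idx p u = 1 then {1..p} else {p - r_idx p u + 2..p})}
     \<inter> pseudo_Frobenius (H_almost p m0 d n)"

(* Rows and columns 0,...,p belong to m_0,...,m_p; row and column p + 1 belong to n. *)
definition RF_matrix :: "nat \<Rightarrow> nat \<Rightarrow> nat \<Rightarrow> nat \<Rightarrow> int \<Rightarrow> int mat \<Rightarrow> bool" where
  "RF_matrix p m0 d n f A \<longleftrightarrow>
     A \<in> carrier_mat (p + 2) (p + 2) \<and>
     (\<forall>i < p + 2. A $$ (i, i) = -1) \<and>
     (\<forall>i < p + 2. \<forall>j < p + 2. i \<noteq> j \<longrightarrow> A $$ (i, j) \<ge> 0) \<and>
     (\<forall>i < p + 2. (\<Sum>j = 0..p. A $$ (i, j) * m_seq m0 d j) + A $$ (i, p + 1) * int n = f)"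

abbreviation E_vec :: "nat \<Rightarrow> nat \<Rightarrow> int vec" where
  "E_vec p i \<equiv> unit_vec (p + 2) i"

end

theory Submission
  imports Defs
begin

text \<open>
  All four kinds of rows are checked from the addition law
  \<open>g\<^sub>a + g\<^sub>b = g\<^sub>a\<^sub>+\<^sub>b + \<delta> m\<^sub>0\<close> with \<open>\<delta> \<in> {0, 1}\<close> and the relations for \<open>g\<^sub>u\<close> and
  \<open>g\<^sub>u\<^sub>-\<^sub>z + (v - w) n\<close>. Nonnegativity of the entries is immediate except in row \<open>n\<close>, where
  \<open>t = z + j - p - 1\<close> must not be negative. If it were, then \<open>\<beta>\<^sub>j + n = g\<^sub>s + (v - w) n - m\<^sub>0\<close> for some
  \<open>0 \<le> s < u - z\<close>; by minimality of \<open>u\<close> and \<open>v\<close> this is not an element of \<open>H\<close>, so \<open>\<beta>\<^sub>j\<close>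
  would not be pseudo-Frobenius.
\<close>

section \<open>Submonoids spanned by a set of integers\<close>

lemma nat_span_zero: "0 \<in> nat_span X"
  unfolding nat_span_def by (force intro: exI[of _ "\<lambda>_. 0"])

lemma nat_span_add:
  assumes "a \<in> nat_span X" "b \<in> nat_span X"
  shows "a + b \<in> nat_span X"
proof -
  obtain c c' where "a = (\<Sum>x\<in>X. int (c x) * x)" "b = (\<Sum>x\<in>X. int (c' x) * x)"
    using assms unfolding nat_span_def by auto
  then have "a + b = (\<Sum>x\<in>X. int (c x + c' x) * x)"
    by (simp add: sum.distrib ring_distribs)
  then show ?thesis
    unfolding nat_span_def by (auto intro!: exI[of _ "\<lambda>x. c x + c' x"])
qed

lemma nat_span_base:
  assumes "finite X" "x \<in> X"
  shows "x \<in> nat_span X"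
proof -
  have "(\<Sum>y\<in>X. int (if y = x then 1 else 0) * y) = (\<Sum>y\<in>X. if y = x then y else 0)"
    by (rule sum.cong) auto
  also have "\<dots> = x"
    using assms by simp
  finally show ?thesis
    unfolding nat_span_def by (auto intro!: exI[of _ "\<lambda>y. if y = x then 1 else 0"])
qed

lemma submonoid_mult:
  fixes S :: "int set"
  assumes "0 \<in> S" "\<And>a b. a \<in> S \<Longrightarrow> b \<in> S \<Longrightarrow> a + b \<in> S" "x \<in> S"
  shows "int k * x \<in> S"
  using assms by (induction k) (auto simp: ring_distribs)

lemma nat_span_mult: "x \<in> nat_span X \<Longrightarrow> k \<ge> 0 \<Longrightarrow> k * x \<in> nat_span X"
  using submonoid_mult[of "nat_span X" x "nat k"] nat_span_zero nat_span_add by auto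

lemma nat_span_least:
  assumes "0 \<in> S" "\<And>a b. a \<in> S \<Longrightarrow> b \<in> S \<Longrightarrow> a + b \<in> S" "X \<subseteq> S"
  shows "nat_span X \<subseteq> S"
proof -
  have "(\<Sum>x\<in>X. int (c x) * x) \<in> S" for c
  proof -
    \<comment> \<open>Induction needs arbitrary subsets \<open>Y\<close>; an infinite
      \<open>Y\<close> gives the sum 0, which lies in \<open>S\<close>.\<close>
    have "(\<Sum>x\<in>Y. int (c x) * x) \<in> S" if "Y \<subseteq> X" for Y
      using that
      by (induction Y rule: infinite_finite_induct)
        (use assms submonoid_mult[OF assms(1,2)] in auto)
    then show ?thesis by simp
  qed
  then show ?thesis
    unfolding nat_span_def by auto
qed

section \<open>The sequence of the \<open>g_seq\<close> values and its addition law\<close>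

lemma q_r_idx_unique:
  assumes "t = a * int p + int b" "b \<in> {1..p}"
  shows "q_idx p t = a" "r_idx p t = b"
proof -
  have eq: "t - 1 = (int b - 1) + a * int p"
    using assms by simp
  have "(t - 1) div int p = a" "(t - 1) mod int p = int b - 1"
    unfolding eq using assms by (auto simp: div_pos_pos_trivial mod_pos_pos_trivial)
  then show "q_idx p t = a" "r_idx p t = b"
    using assms by (auto simp: q_idx_def r_idx_def)
qed

lemma g_seq_eq:
  assumes "t = a * int p + int b" "b \<in> {1..p}"
  shows "g_seq p m0 d t = a * m_seq m0 d p + m_seq m0 d b"
  using q_r_idx_unique[OF assms] by (simp add: g_seq_def)

lemma g_seq_0: "p \<ge> 1 \<Longrightarrow> g_seq p m0 d 0 = 0"
  by (subst g_seq_eq[of _ "-1" p p]) auto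

text \<open>Quotients and remainders add. If the remainders sum to at most \<open>p\<close>, they
  merge by \<open>m_a + m_b = m_0 + m_(a+b)\<close>, which releases one \<open>m0\<close>. Otherwise
  \<open>m_a + m_b = m_p + m_(a+b-p)\<close>, and the extra \<open>m_p\<close> raises the quotient
  by one.\<close>

lemma g_seq_add:
  assumes "p \<ge> 1"
  shows "g_seq p m0 d a + g_seq p m0 d b
    = g_seq p m0 d (a + b) + (if r_idx p a + r_idx p b \<le> p then 1 else 0) * int m0"
proof -
  note A = q_idx_r_idx[OF assms, of a] and B = q_idx_r_idx[OF assms, of b]
  let ?ra = "r_idx p a" and ?rb = "r_idx p b" and ?qa = "q_idx p a" and ?qb = "q_idx p b"
  show ?thesis
  proof (cases "?ra + ?rb \<le> p")
    case True
    have "a + b = (?qa + ?qb) * int p + int (?ra + ?rb)"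
      using A(1) B(1) by (simp add: ring_distribs)
    from g_seq_eq[OF this] True A(2) B(2) show ?thesis
      by (simp add: g_seq_def m_seq_def algebra_simps)
  next
    case False
    have "a + b = (?qa + ?qb + 1) * int p + int (?ra + ?rb - p)"
      using A(1) B(1) False by (simp add: ring_distribs of_nat_diff)
    moreover have "?ra + ?rb - p \<in> {1..p}"
      using False A(2) B(2) by auto
    ultimately show ?thesis using g_seq_eq[of "a + b" "?qa + ?qb + 1" p "?ra + ?rb - p" m0 d] False
      by (simp add: g_seq_def m_seq_def algebra_simps of_nat_diff)
  qed
qed

lemma g_seq_add_cases:
  assumes "p \<ge> 1"
  obtains \<delta> where "\<delta> \<in> {0, 1}"
    "g_seq p m0 d a + g_seq p m0 d b = g_seq p m0 d (a + b) + \<delta> * int m0"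
  using g_seq_add[OF assms, of m0 d a b] that by (cases "r_idx p a + r_idx p b \<le> p") auto

lemma q_idx_nonneg: "t \<ge> 1 \<Longrightarrow> q_idx p t \<ge> 0"
  by (simp add: q_idx_def pos_imp_zdiv_nonneg_iff div_int_pos_iff)

lemma g_seq_pos: "m0 \<ge> 1 \<Longrightarrow> t \<ge> 1 \<Longrightarrow> g_seq p m0 d t > 0"
  using q_idx_nonneg[of t p] unfolding g_seq_def m_seq_def
  by (intro add_nonneg_pos add_pos_nonneg mult_nonneg_nonneg) auto

lemma m_seq_in_H_arith: "i \<le> p \<Longrightarrow> m_seq m0 d i \<in> H_arith p m0 d"
  by (rule nat_span_base) (auto simp: arith_gens_def)

lemma g_seq_in_H_arith:
  assumes "p \<ge> 1" "t \<ge> 0"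
  shows "g_seq p m0 d t \<in> H_arith p m0 d"
proof (cases "t = 0")
  case True
  then show ?thesis using assms nat_span_zero by (simp add: g_seq_0)
next
  case False
  then show ?thesis
    using assms q_idx_nonneg[of t p] q_idx_r_idx(2)[of p t] unfolding g_seq_def
    by (intro nat_span_add nat_span_mult m_seq_in_H_arith) auto
qed

lemma m0_in_H_arith: "int m0 \<in> H_arith p m0 d"
  using m_seq_in_H_arith[of 0 p m0 d] by (simp add: m_seq_def)

lemma H_arith_subset_H_almost: "H_arith p m0 d \<subseteq> H_almost p m0 d n"
  by (rule nat_span_least)
    (auto simp: nat_span_zero nat_span_add almost_arith_gens_def arith_gens_def intro!: nat_span_base)

lemma n_in_H_almost: "int n \<in> H_almost p m0 d n"
  by (rule nat_span_base) (auto simp: almost_arith_gens_def arith_gens_def)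

text \<open>Any sum of the generators \<open>m_i\<close> collapses to one \<open>g_seq\<close> term
  plus copies of \<open>m0\<close>: such expressions are closed under addition, because the carry of
  the addition law is absorbed by the coefficient of \<open>m0\<close>.\<close>

lemma H_almost_cases:
  assumes "p \<ge> 1" "h \<in> H_almost p m0 d n"
  obtains c t b where "c \<ge> 0" "t \<ge> 0" "b \<ge> 0" "h = c * int m0 + g_seq p m0 d t + b * int n"
proof -
  let ?S = "{c * int m0 + g_seq p m0 d t + b * int n | c t b. c \<ge> 0 \<and> t \<ge> 0 \<and> b \<ge> 0}"
  have S: "x \<in> ?S" if "c \<ge> 0" "t \<ge> 0" "b \<ge> 0" "x = c * int m0 + g_seq p m0 d t + b * int n"
    for x c t b
    using that by blast
  have "nat_span (almost_arith_gens p m0 d n) \<subseteq> ?S"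
  proof (rule nat_span_least)
    show "0 \<in> ?S"
      by (rule S[of 0 0 0]) (use assms g_seq_0 in auto)
  next
    fix x y assume "x \<in> ?S" "y \<in> ?S"
    then obtain c t b c' t' b' where nn: "c \<ge> 0" "t \<ge> 0" "b \<ge> 0" "c' \<ge> 0" "t' \<ge> 0" "b' \<ge> 0"
      and x: "x = c * int m0 + g_seq p m0 d t + b * int n"
      and y: "y = c' * int m0 + g_seq p m0 d t' + b' * int n"
      by blast
    obtain \<delta> where "\<delta> \<in> {0, 1}"
      "g_seq p m0 d t + g_seq p m0 d t' = g_seq p m0 d (t + t') + \<delta> * int m0"
      using g_seq_add_cases[OF assms(1)] by blast
    then show "x + y \<in> ?S"
      by (intro S[of "c + c' + \<delta>" "t + t'" "b + b'"]) (use nn x y in \<open>auto simp: ring_distribs\<close>)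
  next
    have "m_seq m0 d i \<in> ?S" if "i \<le> p" for i
    proof (cases "i = 0")
      case True
      then show ?thesis
        by (intro S[of 1 0 0]) (use assms g_seq_0 in \<open>auto simp: m_seq_def\<close>)
    next
      case False
      then show ?thesis
        using g_seq_eq[of "int i" 0 p i m0 d] that by (intro S[of 0 "int i" 0]) auto
    qed
    moreover have "int n \<in> ?S"
      by (rule S[of 0 0 1]) (use assms g_seq_0 in auto)
    ultimately show "almost_arith_gens p m0 d n \<subseteq> ?S"
      by (auto simp: almost_arith_gens_def arith_gens_def)
  qed
  then show thesis
    using assms(2) that by blast
qed

section \<open>Consequences of the minimality of \<open>u\<close> and \<open>v\<close>\<close>

lemma g_seq_less_u_min:
  assumes "p \<ge> 1" "0 \<le> k" "k < int (u_min p m0 d n)" "c \<ge> 1" "t \<ge> 0" "b \<ge> 0"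
  shows "g_seq p m0 d k \<noteq> c * int m0 + g_seq p m0 d t + b * int n"
proof
  assume eq: "g_seq p m0 d k = c * int m0 + g_seq p m0 d t + b * int n"
  have "nat k < u_min p m0 d n"
    using assms by linarith
  then have "g_seq p m0 d (int (nat k)) \<in> Apery (H_almost p m0 d n) (int m0)"
    unfolding u_min_def using not_less_Least by blast
  then have "g_seq p m0 d k - int m0 \<notin> H_almost p m0 d n"
    using assms by (simp add: Apery_def)
  \<comment> \<open>Since \<open>c\<close> is at least 1, one \<open>m0\<close> can be removed
    without leaving the semigroup, against membership in the Apery set.\<close>
  moreover have "g_seq p m0 d k - int m0 = (c - 1) * int m0 + g_seq p m0 d t + b * int n"
    using eq by (simp add: algebra_simps)
  moreover have "(c - 1) * int m0 + g_seq p m0 d t + b * int n \<in> H_almost p m0 d n"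
    using assms m0_in_H_arith[of m0 p d] g_seq_in_H_arith[of p t m0 d]
      H_arith_subset_H_almost[of p m0 d n]
    by (intro nat_span_add nat_span_mult n_in_H_almost) auto
  ultimately show False by simp
qed

lemma multiple_less_v_min:
  assumes "p \<ge> 1" "1 \<le> e" "e < int (v_min p m0 d n)" "c \<ge> 0" "t \<ge> 0"
  shows "e * int n \<noteq> c * int m0 + g_seq p m0 d t"
proof
  assume eq: "e * int n = c * int m0 + g_seq p m0 d t"
  have "nat e < v_min p m0 d n"
    using assms by linarith
  then have "\<not> (nat e \<ge> 1 \<and> int (nat e) * int n \<in> H_arith p m0 d)"
    unfolding v_min_def using not_less_Least by blast
  then have "e * int n \<notin> H_arith p m0 d"
    using assms by auto
  then show False
    using assms unfolding eq
    by (auto intro!: nat_span_add nat_span_mult m0_in_H_arith g_seq_in_H_arith)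
qed

text \<open>A representation in the semigroup is reduced by cancellation to
  \<open>g_k + e n = c' m0\<close> with \<open>0 < k < u - z\<close>. Comparison with the relation
  for \<open>g_u\<close> forces \<open>e = v - w\<close>; comparison with the relation for
  \<open>g_(u-z)\<close> then makes some \<open>g_l\<close> with \<open>0 < l < u\<close> a positive
  multiple of \<open>m0\<close>, which minimality of \<open>u\<close> excludes.\<close>

lemma below_W_box_in_Apery:
  assumes p: "p \<ge> 1" and m0: "m0 \<ge> 1"
    and u: "u = int (u_min p m0 d n)" and v: "v = int (v_min p m0 d n)"
    and z: "z \<ge> 0" and w: "1 \<le> w" "w < v"
    and gu: "g_seq p m0 d u = lam * int m0 + w * int n"
    and guz: "g_seq p m0 d (u - z) + (v - w) * int n = \<nu> * int m0"
    and s: "0 \<le> s" "s < u - z"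
  shows "g_seq p m0 d s + (v - w) * int n - int m0 \<notin> H_almost p m0 d n"
proof
  assume "g_seq p m0 d s + (v - w) * int n - int m0 \<in> H_almost p m0 d n"
  then obtain c t b where nn: "c \<ge> 0" "t \<ge> 0" "b \<ge> 0"
    and "g_seq p m0 d s + (v - w) * int n - int m0 = c * int m0 + g_seq p m0 d t + b * int n"
    using H_almost_cases[OF p] by metis
  then have eq: "g_seq p m0 d s + (v - w) * int n = (c + 1) * int m0 + g_seq p m0 d t + b * int n"
    by (simp add: algebra_simps)
  note add = g_seq_add_cases[OF p, of m0 d]
  note not_u = g_seq_less_u_min[OF p, of _ m0 d n, folded u]
  note not_v = multiple_less_v_min[OF p, of _ m0 d n, folded v]
  define e where "e = v - w - b"
  have eq_e: "g_seq p m0 d s + e * int n = (c + 1) * int m0 + g_seq p m0 d t"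
    using eq by (simp add: e_def algebra_simps)
  \<comment> \<open>Otherwise \<open>- e\<close> copies of \<open>n\<close> move to the right, and
    \<open>g_s\<close> has a representation containing \<open>m0\<close> although
    \<open>s < u\<close>.\<close>
  have e1: "e \<ge> 1"
  proof (rule ccontr)
    assume "\<not> e \<ge> 1"
    then show False
      using not_u[of s "c + 1" t "- e"] s z nn eq_e by (simp add: algebra_simps)
  qed
  \<comment> \<open>Otherwise \<open>g_s\<close> cancels from \<open>g_t\<close>, and
    \<open>e n\<close> lies in the span of the \<open>m_i\<close> although \<open>e < v\<close>. The
    summand 1 in \<open>c + 1\<close> pays for the possible carry.\<close>
  have "s > t"
  proof (rule ccontr)
    assume "\<not> s > t"
    obtain \<delta> where \<delta>: "\<delta> \<in> {0, 1}"
      "g_seq p m0 d s + g_seq p m0 d (t - s) = g_seq p m0 d (s + (t - s)) + \<delta> * int m0"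
      using add .
    then have "e * int n = (c + 1 - \<delta>) * int m0 + g_seq p m0 d (t - s)"
      using eq_e by (simp add: algebra_simps)
    then show False
      using not_v[of e "c + 1 - \<delta>" "t - s"] \<delta>(1) e1 \<open>\<not> s > t\<close> nn w by (auto simp: e_def)
  qed
  define k where "k = s - t"
  have k: "1 \<le> k" "k < u - z"
    using \<open>s > t\<close> s nn by (auto simp: k_def)
  obtain c' where c': "g_seq p m0 d k + e * int n = c' * int m0"
  proof -
    obtain \<delta> where "g_seq p m0 d k + g_seq p m0 d t = g_seq p m0 d (k + t) + \<delta> * int m0"
      using add by blast
    then have "g_seq p m0 d k + e * int n = (c + 1 + \<delta>) * int m0"
      using eq_e by (simp add: k_def algebra_simps)
    then show thesis using that by blast
  qed
  \<comment> \<open>If \<open>e < v - w\<close>, then \<open>w + e < v\<close>. Completing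
    \<open>k\<close> to \<open>u\<close> relates \<open>g_(u-k)\<close> and \<open>(w + e) n\<close>
    by a multiple of \<open>m0\<close>; either sign of its coefficient is impossible, one by
    minimality of \<open>v\<close>, the other by minimality of \<open>u\<close>.\<close>
  have "e = v - w"
  proof (rule ccontr)
    assume "e \<noteq> v - w"
    then have e2: "e < v - w"
      using nn by (simp add: e_def)
    obtain \<delta> where "g_seq p m0 d (u - k) + g_seq p m0 d k = g_seq p m0 d (u - k + k) + \<delta> * int m0"
      using add by blast
    then have eq': "g_seq p m0 d (u - k) + (c' - \<delta> - lam) * int m0 = (w + e) * int n"
      using c' gu by (simp add: algebra_simps)
    show False
    proof (cases "c' - \<delta> - lam \<ge> 0")
      case True
      then show False
        using not_v[of "w + e" "c' - \<delta> - lam" "u - k"] eq' e1 e2 w k z by (simp add: algebra_simps)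
    next
      case False
      then show False
        using not_u[of "u - k" "- (c' - \<delta> - lam)" 0 "w + e"] eq' e1 w k z
        by (simp add: g_seq_0[OF p] algebra_simps)
    qed
  qed
  \<comment> \<open>Both relations now contain the same multiple of \<open>n\<close>, so it cancels
    and only \<open>g_l\<close> and multiples of \<open>m0\<close> remain.\<close>
  define l where "l = u - z - k"
  obtain \<delta> where "g_seq p m0 d l + g_seq p m0 d k = g_seq p m0 d (l + k) + \<delta> * int m0"
    using add by blast
  then have l: "g_seq p m0 d l = (\<nu> - c' + \<delta>) * int m0"
    using c' guz by (simp add: \<open>e = v - w\<close> l_def algebra_simps)
  have "g_seq p m0 d l > 0"
    using m0 k by (intro g_seq_pos) (auto simp: l_def)
  then have "\<nu> - c' + \<delta> > 0"
    unfolding l using m0 by (simp add: zero_less_mult_iff)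
  then show False
    using not_u[of l "\<nu> - c' + \<delta>" 0 0] l k z by (simp add: g_seq_0[OF p] l_def)
qed

section \<open>Rows of RF-matrices as vectors\<close>

definition gen_vec :: "nat \<Rightarrow> nat \<Rightarrow> nat \<Rightarrow> nat \<Rightarrow> int vec" where
  "gen_vec p m0 d n = vec (p + 2) (\<lambda>i. if i \<le> p then m_seq m0 d i else int n)"

lemma gen_vec_carrier [simp]: "gen_vec p m0 d n \<in> carrier_vec (p + 2)"
  by (simp add: gen_vec_def)

lemma dim_gen_vec: "dim_vec (gen_vec p m0 d n) = p + 2"
  by (simp add: gen_vec_def)

lemma gen_vec_index:
  "i < p + 2 \<Longrightarrow> gen_vec p m0 d n $ i = (if i \<le> p then m_seq m0 d i else int n)"
  by (simp add: gen_vec_def)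

lemmas gen_vec_simps =
  add_scalar_prod_distrib[OF _ _ gen_vec_carrier]
  minus_scalar_prod_distrib[OF _ _ gen_vec_carrier]
  smult_scalar_prod_distrib[OF _ gen_vec_carrier]
  gen_vec_index dim_gen_vec

lemma scalar_prod_gen_vec:
  assumes "x \<in> carrier_vec (p + 2)"
  shows "x \<bullet> gen_vec p m0 d n = (\<Sum>j = 0..p. x $ j * m_seq m0 d j) + x $ (p + 1) * int n"
proof -
  have "{0..<p + 2} = insert (p + 1) {0..p}" by auto
  then show ?thesis
    by (simp add: scalar_prod_def gen_vec_def)
qed

text \<open>The pairing with \<open>gen_vec\<close> is linear, so each row sum can be computed from
  the unit vectors in the row formula.\<close>

lemma RF_matrix_of_rows:
  assumes "\<And>i. i < p + 2 \<Longrightarrow> R i \<in> carrier_vec (p + 2)"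
    and "\<And>i. i < p + 2 \<Longrightarrow> R i $ i = -1"
    and "\<And>i j. i < p + 2 \<Longrightarrow> j < p + 2 \<Longrightarrow> i \<noteq> j \<Longrightarrow> R i $ j \<ge> 0"
    and "\<And>i. i < p + 2 \<Longrightarrow> R i \<bullet> gen_vec p m0 d n = f"
  obtains A where "RF_matrix p m0 d n f A" "\<And>i. i < p + 2 \<Longrightarrow> row A i = R i"
proof
  let ?A = "mat (p + 2) (p + 2) (\<lambda>(i, j). R i $ j)"
  show "RF_matrix p m0 d n f ?A"
    unfolding RF_matrix_def using assms(2-4) scalar_prod_gen_vec[OF assms(1)] by simp
  show "row ?A i = R i" if "i < p + 2" for i
    using assms(1)[OF that] that by (intro eq_vecI) auto
qed

theorem proposition4p7:
  fixes p d m0 n :: nat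
    and u v z w lam \<mu> \<nu> q q' :: int
    and r r' :: nat
  assumes "p \<ge> 1" and "d \<ge> 1" and "m0 \<ge> 1" and "n \<ge> 1"
    and "Gcd {m0, d, n} = 1"
    and "minimal_generating_set (almost_arith_gens p m0 d n) (H_almost p m0 d n)"
    and "u = int (u_min p m0 d n)" and "v = int (v_min p m0 d n)"
    and "z \<in> {0..u - 1}" and "w \<in> {0..v - 1}" and "lam \<ge> 1" and "\<mu> \<ge> 0"
    and "\<nu> = nu p u z lam \<mu>"
    and "g_seq p m0 d u = lam * int m0 + w * int n"
    and "v * int n = \<mu> * int m0 + g_seq p m0 d z"
    and "g_seq p m0 d (u - z) + (v - w) * int n = \<nu> * int m0"
    and "r = r_idx p u" and "q = q_idx p u"
    and "r' = r_idx p (u - z)" and "q' = q_idx p (u - z)"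
    and "W_box u v z w \<noteq> {}"
    and "r = 1" and "lam > 1"
  shows "\<forall>j \<in> {1..p}. PF_beta p m0 d n u v w j \<in> PF2 p m0 d n u v w \<longrightarrow>
    (\<exists>A. RF_matrix p m0 d n (PF_beta p m0 d n u v w j) A \<and>
      row A 0 = - E_vec p 0 + (q - 1) \<cdot>\<^sub>v E_vec p p + (v - w - 1) \<cdot>\<^sub>v E_vec p (p + 1) + E_vec p j \<and>
      (\<forall>k \<in> {1..p - j}.
        row A k = - E_vec p k + (q - 1) \<cdot>\<^sub>v E_vec p p + (v - w - 1) \<cdot>\<^sub>v E_vec p (p + 1)
                  + E_vec p (j + k)) \<and>
      (\<forall>k \<in> {p - j + 1..p}.
        row A k = (lam - 2) \<cdot>\<^sub>v E_vec p 0 - E_vec p k + (v - 1) \<cdot>\<^sub>v E_vec p (p + 1)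
                  + E_vec p (k + j - p - 1)) \<and>
      (let t = z + int j - int p - 1;
           \<epsilon> = (if r' + r_idx p t \<le> p then 2 else 1)
       in row A (p + 1) = (\<nu> - \<epsilon>) \<cdot>\<^sub>v E_vec p 0 + q_idx p t \<cdot>\<^sub>v E_vec p p - E_vec p (p + 1)
                          + E_vec p (r_idx p t)))"
proof (intro ballI impI)
  fix j assume j: "j \<in> {1..p}" and PF: "PF_beta p m0 d n u v w j \<in> PF2 p m0 d n u v w"
  note p = assms(1) and uz = assms(16)
  define \<beta> where "\<beta> = PF_beta p m0 d n u v w j"
  define t where "t = z + int j - int p - 1"
  define \<epsilon> where "\<epsilon> = (if r' + r_idx p t \<le> p then 2 else 1 :: int)"
  have W: "1 \<le> z" "z < u" "1 \<le> w" "w < v"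
    using assms(9,10,21) by (auto simp: W_box_def)
  have ru: "r_idx p u = 1"
    using assms(17,22) by simp
  have u: "u = q * int p + 1"
    using q_idx_r_idx(1)[OF p, of u] ru assms(18) by simp
  \<comment> \<open>From \<open>1 \<le> z < u\<close> follows \<open>u \<ge> 2\<close>, while
    \<open>q \<le> 0\<close> would give \<open>u \<le> 1\<close>.\<close>
  have q: "q \<ge> 1"
  proof (rule ccontr)
    assume "\<not> q \<ge> 1"
    then have "q * int p \<le> 0"
      by (simp add: mult_nonpos_nonneg)
    then show False using u W by simp
  qed
  \<comment> \<open>Two readings of the index of \<open>\<beta>\<close>: the left side serves rows
    \<open>0\<close> to \<open>p\<close>, the right side serves row \<open>n\<close>.\<close>
  have s: "(q - 1) * int p + int j = u - z + t"
    using u by (simp add: t_def algebra_simps)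
  have \<beta>_g: "\<beta> = g_seq p m0 d (u - z + t) + (v - w - 1) * int n - int m0"
    using s ru assms(18) by (simp add: \<beta>_def PF_beta_def)
  have \<beta>: "\<beta> = (q - 1) * m_seq m0 d p + m_seq m0 d j + (v - w - 1) * int n - int m0"
    using g_seq_eq[OF s[symmetric] j] \<beta>_g by simp
  \<comment> \<open>This keeps the entry \<open>\<nu> - \<epsilon>\<close> nonnegative, as
    \<open>\<epsilon> \<le> 2\<close>; it comes from \<open>lam > 1\<close>.\<close>
  have \<nu>: "\<nu> \<ge> 2"
    using assms(12,13,23) ru by (auto simp: nu_def)
  have t: "t \<ge> 0"
  proof (rule ccontr)
    assume "\<not> t \<ge> 0"
    moreover have "u - z + t \<ge> 0"
      unfolding s[symmetric] using q by simp
    ultimately have "g_seq p m0 d (u - z + t) + (v - w) * int n - int m0 \<notin> H_almost p m0 d n"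
      using below_W_box_in_Apery[OF p assms(3,7,8) _ W(3,4) assms(14,16)] W by simp
    moreover have "\<beta> + int n \<in> H_almost p m0 d n"
      using PF n_in_H_almost[of n p m0 d] assms(4)
      by (auto simp: \<beta>_def PF2_def pseudo_Frobenius_def)
    ultimately show False
      by (simp add: \<beta>_g algebra_simps)
  qed
  let ?R0 = "- E_vec p 0 + (q - 1) \<cdot>\<^sub>v E_vec p p + (v - w - 1) \<cdot>\<^sub>v E_vec p (p + 1) + E_vec p j"
  let ?R1 = "\<lambda>k. - E_vec p k + (q - 1) \<cdot>\<^sub>v E_vec p p + (v - w - 1) \<cdot>\<^sub>v E_vec p (p + 1)
    + E_vec p (j + k)"
  let ?R2 = "\<lambda>k. (lam - 2) \<cdot>\<^sub>v E_vec p 0 - E_vec p k + (v - 1) \<cdot>\<^sub>v E_vec p (p + 1)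
    + E_vec p (k + j - p - 1)"
  let ?R3 = "(\<nu> - \<epsilon>) \<cdot>\<^sub>v E_vec p 0 + q_idx p t \<cdot>\<^sub>v E_vec p p - E_vec p (p + 1)
    + E_vec p (r_idx p t)"
  define R where "R i = (if i = 0 then ?R0 else if i \<le> p - j then ?R1 i
    else if i \<le> p then ?R2 i else ?R3)" for i
  have R: "R 0 = ?R0" "\<And>k. k \<in> {1..p - j} \<Longrightarrow> R k = ?R1 k"
    "\<And>k. k \<in> {p - j + 1..p} \<Longrightarrow> R k = ?R2 k" "R (p + 1) = ?R3"
    using j by (auto simp: R_def)
  have cases: "i = 0 \<or> i \<in> {1..p - j} \<or> i \<in> {p - j + 1..p} \<or> i = p + 1" if "i < p + 2" for i
    using that by auto
  have rt: "1 \<le> r_idx p t" "r_idx p t \<le> p"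
    using q_idx_r_idx(2)[OF p, of t] by auto
  \<comment> \<open>For \<open>t = 0\<close> the entry \<open>q\<^sub>0 = -1\<close> in column \<open>p\<close> is cancelled by \<open>r\<^sub>0 = p\<close>.\<close>
  have q_t: "q_idx p t \<ge> 0 \<or> q_idx p t = -1 \<and> r_idx p t = p"
    using t q_idx_nonneg[of t p] q_r_idx_unique[of 0 "-1" p p] p by (cases "t = 0") auto
  have carrier: "R i \<in> carrier_vec (p + 2)" for i
    by (simp add: R_def)
  \<comment> \<open>No positive term meets the diagonal: \<open>j > 0\<close>,
    \<open>j + k > k\<close>, \<open>k + j - p - 1 < k\<close>, and
    \<open>r_idx p t < p + 1\<close>; in the second kind of row also \<open>k < p\<close>.\<close>
  have diag: "R i $ i = -1" if "i < p + 2" for i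
    using cases[OF that]
    by (elim disjE) (use j p rt in \<open>auto simp: R R(4)[simplified]\<close>)
  have off_diag: "R i $ k \<ge> 0" if "i < p + 2" "k < p + 2" "i \<noteq> k" for i k
    using cases[OF that(1)]
    by (elim disjE) (use that j p rt q q_t W assms(23) \<nu> in \<open>auto simp: R R(4)[simplified] \<epsilon>_def\<close>)
  have row_0: "?R0 \<bullet> gen_vec p m0 d n = \<beta>"
    using j by (simp add: gen_vec_simps \<beta> m_seq_def del: add_2_eq_Suc')
  \<comment> \<open>Row 0 is altered by \<open>m_0 + m_(j+k) = m_j + m_k\<close>.\<close>
  have row_1: "?R1 k \<bullet> gen_vec p m0 d n = \<beta>" if "k \<in> {1..p - j}" for k
  proof -
    have "k \<le> p" "k < p + 2" "j + k \<le> p" "j + k < p + 2"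
      using that j by auto
    then show ?thesis
      using j by (simp add: gen_vec_simps \<beta> m_seq_def algebra_simps del: add_2_eq_Suc')
  qed
  \<comment> \<open>The relation for \<open>g_u\<close> trades \<open>lam m_0 + w n\<close> for
    \<open>q m_p + m_1\<close>. What remains is \<open>m_p + m_1 + m_i = m_0 + m_j + m_k\<close>,
    true because \<open>k + j = i + p + 1\<close>; the lower bound on \<open>k\<close> prevents
    truncation in \<open>i\<close>.\<close>
  have row_2: "?R2 k \<bullet> gen_vec p m0 d n = \<beta>" if "k \<in> {p - j + 1..p}" for k
  proof -
    define i where "i = k + j - p - 1"
    have i: "k + j = i + p + 1" "i \<le> p"
      using that j by (auto simp: i_def)
    then have "i < p + 2" "k \<le> p" "k < p + 2"
      using that by auto
    moreover have "q * m_seq m0 d p + m_seq m0 d 1 = lam * int m0 + w * int n"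
      using assms(14,18) ru by (simp add: g_seq_def)
    moreover have "int d * int k = int d * (int i + int p + 1 - int j)"
      using i by (auto simp: eq_diff_eq simp flip: of_nat_add)
    ultimately show ?thesis
      using j i(2) unfolding i_def[symmetric]
      by (simp add: gen_vec_simps \<beta> m_seq_def algebra_simps del: add_2_eq_Suc')
  qed
  have row_3: "?R3 \<bullet> gen_vec p m0 d n = \<beta>"
  proof -
    \<comment> \<open>The carry of the addition law is \<open>\<epsilon> - 1\<close>; the other
      \<open>m0\<close> in \<open>\<epsilon>\<close> is the one subtracted in
      \<open>\<beta>\<close>.\<close>
    have "g_seq p m0 d (u - z) + g_seq p m0 d t = g_seq p m0 d (u - z + t) + (\<epsilon> - 1) * int m0"
      using g_seq_add[OF p, of m0 d "u - z" t] assms(19) by (simp add: \<epsilon>_def)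
    then have "\<beta> = (\<nu> - \<epsilon>) * int m0 + g_seq p m0 d t - int n"
      using uz by (simp add: \<beta>_g algebra_simps)
    then show ?thesis
      using rt
      by (simp add: gen_vec_simps g_seq_def del: add_2_eq_Suc') (simp add: m_seq_def)
  qed
  have rows: "R i \<bullet> gen_vec p m0 d n = \<beta>" if "i < p + 2" for i
    using cases[OF that] R row_0 row_1 row_2 row_3 by auto
  obtain A where RF: "RF_matrix p m0 d n \<beta> A" and A: "\<And>i. i < p + 2 \<Longrightarrow> row A i = R i"
    using RF_matrix_of_rows[OF carrier diag off_diag rows] by blast
  have "row A 0 = ?R0" "\<forall>k \<in> {1..p - j}. row A k = ?R1 k"
    "\<forall>k \<in> {p - j + 1..p}. row A k = ?R2 k" "row A (p + 1) = ?R3"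
    using A R by auto
  then show "\<exists>A. RF_matrix p m0 d n (PF_beta p m0 d n u v w j) A \<and>
      row A 0 = ?R0 \<and> (\<forall>k \<in> {1..p - j}. row A k = ?R1 k) \<and>
      (\<forall>k \<in> {p - j + 1..p}. row A k = ?R2 k) \<and>
      (let t = z + int j - int p - 1;
           \<epsilon> = (if r' + r_idx p t \<le> p then 2 else 1)
       in row A (p + 1) = (\<nu> - \<epsilon>) \<cdot>\<^sub>v E_vec p 0 + q_idx p t \<cdot>\<^sub>v E_vec p p - E_vec p (p + 1)
                          + E_vec p (r_idx p t))"
    using RF unfolding \<beta>_def \<epsilon>_def t_def Let_def by blast
qed

end
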